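(* Let $\mathcal{A}$ be a finite family, with $q=|\mathcal{A}|\ge 2$, of permutations of the vertices of $M(2)$ all having the same number of blank spaces, and let $p$ be a positive integer. Let $l = 2\lceil \log_{q} p\rceil$, let $P$ be the least power of $q$ that is not less than $p$, and let $a = \alpha(H_{\mathcal{A},M(2)})/q$. Then there exists a family $\mathcal{F}_l$ of $p$ permutations of the vertices of $M(l)$ (with some number of blank spaces) such that \[ \alpha(H_{\mathcal{F}_l,M(l)}) \leq P\cdot a^{l/2}. \]
   Context: $M(m)$ (for even $m$) denotes the graph on $m$ vertices consisting of $m/2$ disjoint edges; $M(2)$ is a single edge. For a finite graph $G$ with $n$ vertices and an integer $b\ge 0$, a permutation of the vertices of $G$ with $b$ blank spaces is a sequence of length $n+b$ in which every vertex of $G$ appears exactly once and the remaining $b$ entries are a blank symbol $*$. Two such sequences $\pi,\sigma$ of equal length are $G$-different if there is a position $i$ such that $\pi(i),\sigma(i)$ are both vertices and $\{\pi(i),\sigma(i)\}$ is an edge of $G$. For a family $\mathcal{F}$ of such sequences of equal length, $H_{\mathcal{F},G}$ is the graph whose vertices are the members of $\mathcal{F}$, two being adjacent iff they are $G$-different; $\alpha$ denotes the independence number. *)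

theory Defs
  imports Complex_Main "HOL-Library.Ramsey"
begin

text \<open>A finite simple graph is a pair of its vertex set and its set of edges, an edge being a
  two-element set of vertices. \<close>

type_synonym 'a graph = "'a set \<times> 'a set set"

abbreviation verts :: "'a graph \<Rightarrow> 'a set" where "verts \<equiv> fst"
abbreviation edges :: "'a graph \<Rightarrow> 'a set set" where "edges \<equiv> snd"

definition independence_number :: "'a graph \<Rightarrow> nat" where
  "independence_number G = Max {card S | S. S \<subseteq> verts G \<and> indep S (edges G)}"

definition matching_graph :: "nat \<Rightarrow> nat graph" where
  "matching_graph m = ({..<m}, {{2 * i, 2 * i + 1} | i. i < m div 2})"

text \<open>In a sequence over the vertices, \<^const>\<open>None\<close> is the blank symbol. The length together
  with the other two conditions forces it to occur exactly \<open>b\<close> times.\<close>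

definition blank_perms :: "'a graph \<Rightarrow> nat \<Rightarrow> 'a option list set" where
  "blank_perms G b = {\<pi>. length \<pi> = card (verts G) + b
     \<and> set \<pi> \<subseteq> insert None (Some ` verts G)
     \<and> (\<forall>v \<in> verts G. count_list \<pi> (Some v) = 1)}"

definition graph_different :: "'a graph \<Rightarrow> 'a option list \<Rightarrow> 'a option list \<Rightarrow> bool" where
  "graph_different G \<pi> \<sigma> \<longleftrightarrow>
     (\<exists>i u v. i < length \<pi> \<and> i < length \<sigma>
        \<and> \<pi> ! i = Some u \<and> \<sigma> ! i = Some v \<and> {u, v} \<in> edges G)"

definition difference_graph :: "'a option list set \<Rightarrow> 'a graph \<Rightarrow> 'a option list graph" where
  "difference_graph \<F> G =
     (\<F>, {{\<pi>, \<sigma>} | \<pi> \<sigma>. \<pi> \<in> \<F> \<and> \<sigma> \<in> \<F> \<and> \<pi> \<noteq> \<sigma> \<and> graph_different G \<pi> \<sigma>})"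

end

theory Submission
  imports Defs
begin

text \<open>Placing a member of one family on the first edges and a member of another on the remaining
  edges makes two concatenations different as soon as one of their parts is. Hence both projections
  of an independent set are independent, and the independence number is submultiplicative under this
  product. The \<open>k\<close>-th power of \<open>\<A>\<close>, with \<open>k = \<lceil>log\<^sub>q p\<rceil>\<close>, has \<open>q ^ k = P \<ge> p\<close> members and
  independence number at most \<open>(q a) ^ k = P a ^ k\<close>; any \<open>p\<close> of its members will do.\<close>

section \<open>Independent sets in difference graphs\<close>

lemma graph_different_sym: "graph_different G \<pi> \<sigma> \<Longrightarrow> graph_different G \<sigma> \<pi>"
  unfolding graph_different_def by (metis insert_commute)

text \<open>The condition on the right does not mention \<open>\<F>\<close>, so independence of
  \<open>S\<close> can be moved from one family containing \<open>S\<close> to another.\<close>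

lemma indep_difference_graph_iff:
  assumes "S \<subseteq> \<F>"
  shows "indep S (edges (difference_graph \<F> G)) \<longleftrightarrow>
    (\<forall>\<pi>\<in>S. \<forall>\<sigma>\<in>S. \<pi> \<noteq> \<sigma> \<longrightarrow> \<not> graph_different G \<pi> \<sigma>)"
  using assms graph_different_sym[of G]
  unfolding indep_def difference_graph_def by (auto simp: doubleton_eq_iff) blast+

lemma finite_independent_cards:
  assumes "finite (verts G)"
  shows "finite {card S | S. S \<subseteq> verts G \<and> indep S (edges G)}"
proof -
  have "{card S | S. S \<subseteq> verts G \<and> indep S (edges G)} \<subseteq> card ` Pow (verts G)"
    by auto
  then show ?thesis
    using assms finite_subset by blast
qed

lemma card_le_independence_number:
  assumes "finite (verts G)" "S \<subseteq> verts G" "indep S (edges G)"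
  shows "card S \<le> independence_number G"
  unfolding independence_number_def
  using finite_independent_cards[OF assms(1)] assms(2,3) by (intro Max_ge) auto

lemma independence_number_le:
  assumes "finite (verts G)"
    and "\<And>S. S \<subseteq> verts G \<Longrightarrow> indep S (edges G) \<Longrightarrow> card S \<le> n"
  shows "independence_number G \<le> n"
proof -
  \<comment> \<open>The empty set makes the set of cardinalities nonempty, without which
    \<open>Max\<close> cannot be bounded.\<close>
  have "indep {} (edges G)"
    by (simp add: indep_def)
  then have "{card S | S. S \<subseteq> verts G \<and> indep S (edges G)} \<noteq> {}"
    by blast
  then show ?thesis
    unfolding independence_number_def
    using finite_independent_cards[OF assms(1)] assms(2) by (subst Max_le_iff) auto
qed

lemma verts_difference_graph [simp]: "verts (difference_graph \<F> G) = \<F>"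
  by (simp add: difference_graph_def)

text \<open>The difference graph of a subfamily is an induced subgraph, so its independent sets stay
  independent in the larger one. This allows a family to be cut down to exactly \<open>p\<close>
  members.\<close>

lemma independence_number_difference_graph_mono:
  assumes "finite \<F>" "\<F>' \<subseteq> \<F>"
  shows "independence_number (difference_graph \<F>' G) \<le> independence_number (difference_graph \<F> G)"
proof (rule independence_number_le)
  show "finite (verts (difference_graph \<F>' G))"
    using assms finite_subset by auto
next
  fix S
  assume S: "S \<subseteq> verts (difference_graph \<F>' G)" "indep S (edges (difference_graph \<F>' G))"
  then have "S \<subseteq> \<F>'" "S \<subseteq> \<F>"
    using assms by auto
  then show "card S \<le> independence_number (difference_graph \<F> G)"
    using S assms(1) by (intro card_le_independence_number) (simp_all add: indep_difference_graph_iff)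
qed

section \<open>Concatenation of sequences over disjoint matchings\<close>

text \<open>The shift by \<open>m\<close> makes the two vertex sets disjoint and leaves blanks
  blank. The number \<open>m\<close> is a separate argument because blanks make the length of
  \<open>\<pi>\<close> differ from its number of vertices.\<close>

definition juxtapose :: "nat \<Rightarrow> nat option list \<Rightarrow> nat option list \<Rightarrow> nat option list" where
  "juxtapose m \<pi> \<sigma> = \<pi> @ map (map_option ((+) m)) \<sigma>"

text \<open>Equal lengths of the first parts fix where the sequence is cut, and the shift is
  injective.\<close>

lemma juxtapose_eq_iff:
  assumes "length \<pi> = length \<pi>'"
  shows "juxtapose m \<pi> \<sigma> = juxtapose m \<pi>' \<sigma>' \<longleftrightarrow> \<pi> = \<pi>' \<and> \<sigma> = \<sigma>'"
proof -
  have "inj (map (map_option ((+) m)))"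
    by (intro list.inj_map option.inj_map) (simp add: inj_def)
  then show ?thesis
    using assms by (simp add: juxtapose_def inj_eq)
qed

lemma verts_matching_graph [simp]: "verts (matching_graph m) = {..<m}"
  by (simp add: matching_graph_def)

lemma length_blank_perms:
  "\<pi> \<in> blank_perms (matching_graph m) c \<Longrightarrow> length \<pi> = m + c"
  by (simp add: blank_perms_def)

text \<open>A vertex below \<open>m\<close> can occur only in the first part, and any other only in
  the shifted second part, where the shift preserves multiplicities.\<close>

lemma juxtapose_in_blank_perms:
  assumes \<pi>: "\<pi> \<in> blank_perms (matching_graph m) c"
    and \<sigma>: "\<sigma> \<in> blank_perms (matching_graph n) d"
  shows "juxtapose m \<pi> \<sigma> \<in> blank_perms (matching_graph (m + n)) (c + d)"
proof -
  have "set \<pi> \<subseteq> insert None (Some ` {..<m})" "set \<sigma> \<subseteq> insert None (Some ` {..<n})"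
    using \<pi> \<sigma> by (auto simp: blank_perms_def)
  then have sets: "set (juxtapose m \<pi> \<sigma>) \<subseteq> insert None (Some ` {..<m + n})"
    by (fastforce simp: juxtapose_def)
  have "count_list (juxtapose m \<pi> \<sigma>) (Some v) = 1" if v: "v < m + n" for v
  proof (cases "v < m")
    case True
    then have "Some v \<notin> set (map (map_option ((+) m)) \<sigma>)"
      by (auto simp: map_option_case split: option.splits)
    then have "count_list (map (map_option ((+) m)) \<sigma>) (Some v) = 0"
      by (simp only: count_list_0_iff not_False_eq_True)
    then show ?thesis
      using True \<pi> by (simp add: juxtapose_def blank_perms_def)
  next
    case False
    then obtain w where w: "v = m + w" "w < n"
      using v by (metis add_less_cancel_left le_Suc_ex not_less)
    have "Some v \<notin> set \<pi>"
      using \<open>set \<pi> \<subseteq> _\<close> False by auto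
    moreover have "count_list (map (map_option ((+) m)) \<sigma>) (Some v) = count_list \<sigma> (Some w)"
      by (induction \<sigma>) (auto simp: w)
    ultimately show ?thesis
      using \<sigma> w by (simp add: juxtapose_def blank_perms_def)
  qed
  then show ?thesis
    using sets length_blank_perms[OF \<pi>] length_blank_perms[OF \<sigma>]
    by (simp add: blank_perms_def juxtapose_def)
qed

text \<open>Evenness of \<open>m\<close> makes the shift send edges to edges; the equal lengths of
  the first parts align the second parts position by position.\<close>

lemma graph_different_juxtapose:
  assumes "even m" "length \<pi> = length \<pi>'"
    and "graph_different (matching_graph m) \<pi> \<pi>' \<or> graph_different (matching_graph n) \<sigma> \<sigma>'"
  shows "graph_different (matching_graph (m + n)) (juxtapose m \<pi> \<sigma>) (juxtapose m \<pi>' \<sigma>')"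
  using assms(3)
proof
  assume "graph_different (matching_graph m) \<pi> \<pi>'"
  then obtain i u v where "i < length \<pi>" "i < length \<pi>'" "\<pi> ! i = Some u" "\<pi>' ! i = Some v"
    and e: "{u, v} \<in> edges (matching_graph m)"
    unfolding graph_different_def by blast
  moreover have "{u, v} \<in> edges (matching_graph (m + n))"
  proof -
    obtain j where j: "{u, v} = {2 * j, 2 * j + 1}" "j < m div 2"
      using e by (auto simp: matching_graph_def)
    moreover have "j < (m + n) div 2"
      using j(2) by linarith
    ultimately show ?thesis
      by (auto simp: matching_graph_def)
  qed
  ultimately show ?thesis
    unfolding graph_different_def juxtapose_def
    by (intro exI[of _ i] exI[of _ u] exI[of _ v]) (simp add: nth_append)
next
  assume "graph_different (matching_graph n) \<sigma> \<sigma>'"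
  then obtain i u v where "i < length \<sigma>" "i < length \<sigma>'" "\<sigma> ! i = Some u" "\<sigma>' ! i = Some v"
    and e: "{u, v} \<in> edges (matching_graph n)"
    unfolding graph_different_def by blast
  moreover have "{m + u, m + v} \<in> edges (matching_graph (m + n))"
  proof -
    obtain j where j: "{u, v} = {2 * j, 2 * j + 1}" "j < n div 2"
      using e by (auto simp: matching_graph_def)
    obtain h where h: "m = 2 * h"
      using assms(1) by blast
    \<comment> \<open>Writing the pair as an image avoids deciding which of \<open>u\<close> and
      \<open>v\<close> is the even endpoint.\<close>
    have "{m + u, m + v} = (+) m ` {u, v}"
      by simp
    also have "\<dots> = {2 * (h + j), 2 * (h + j) + 1}"
      by (simp add: j(1) h)
    finally have "{m + u, m + v} = {2 * (h + j), 2 * (h + j) + 1}" .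
    moreover have "h + j < (m + n) div 2"
      using j(2) h by linarith
    ultimately show ?thesis
      unfolding matching_graph_def snd_conv by blast
  qed
  ultimately show ?thesis
    using assms(2) unfolding graph_different_def juxtapose_def
    by (intro exI[of _ "length \<pi> + i"] exI[of _ "m + u"] exI[of _ "m + v"]) (simp add: nth_append)
qed

text \<open>An independent set lies in the product of its two projections \<open>S1\<close> and
  \<open>S2\<close>, each of which is independent in its own factor. The common blank count
  \<open>c\<close> gives all members of \<open>\<F>\<close> the same length.\<close>

lemma independence_number_juxtapose:
  assumes "even m" "finite \<F>" "finite \<A>"
    and \<F>: "\<F> \<subseteq> blank_perms (matching_graph m) c"
  shows "independence_number (difference_graph (case_prod (juxtapose m) ` (\<F> \<times> \<A>))
      (matching_graph (m + n)))
    \<le> independence_number (difference_graph \<F> (matching_graph m))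
      * independence_number (difference_graph \<A> (matching_graph n))"
    (is "independence_number (difference_graph ?J _) \<le> ?f * ?a")
proof (rule independence_number_le)
  show "finite (verts (difference_graph ?J (matching_graph (m + n))))"
    using assms by simp
next
  fix S
  assume "S \<subseteq> verts (difference_graph ?J (matching_graph (m + n)))"
    and ind: "indep S (edges (difference_graph ?J (matching_graph (m + n))))"
  then have S: "S \<subseteq> ?J"
    by simp
  define S1 where "S1 = {\<pi>\<in>\<F>. \<exists>\<sigma>\<in>\<A>. juxtapose m \<pi> \<sigma> \<in> S}"
  define S2 where "S2 = {\<sigma>\<in>\<A>. \<exists>\<pi>\<in>\<F>. juxtapose m \<pi> \<sigma> \<in> S}"
  have len: "length \<pi> = length \<pi>'" if "\<pi> \<in> \<F>" "\<pi>' \<in> \<F>" for \<pi> \<pi>'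
    using that \<F> length_blank_perms by (metis subsetD)
  \<comment> \<open>A difference in either part would make two distinct members of \<open>S\<close>
    different. The other parts are arbitrary, so any witnesses of membership in \<open>S1\<close> or
    \<open>S2\<close> can be used.\<close>
  have same: "\<not> graph_different (matching_graph m) \<pi> \<pi>' \<and> \<not> graph_different (matching_graph n) \<sigma> \<sigma>'"
    if "\<pi> \<in> \<F>" "\<pi>' \<in> \<F>" "juxtapose m \<pi> \<sigma> \<in> S" "juxtapose m \<pi>' \<sigma>' \<in> S" "\<pi> \<noteq> \<pi>' \<or> \<sigma> \<noteq> \<sigma>'"
    for \<pi> \<pi>' \<sigma> \<sigma>'
  proof -
    have "juxtapose m \<pi> \<sigma> \<noteq> juxtapose m \<pi>' \<sigma>'"
      using that juxtapose_eq_iff[OF len] by blast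
    then show ?thesis
      using that ind[unfolded indep_difference_graph_iff[OF S]]
        graph_different_juxtapose[OF assms(1) len] by blast
  qed
  have "card S1 \<le> ?f"
  proof (rule card_le_independence_number)
    have "S1 \<subseteq> \<F>"
      by (auto simp: S1_def)
    then show "indep S1 (edges (difference_graph \<F> (matching_graph m)))"
      using same by (auto simp: indep_difference_graph_iff S1_def)
  qed (use assms in \<open>auto simp: S1_def\<close>)
  moreover have "card S2 \<le> ?a"
  proof (rule card_le_independence_number)
    have "S2 \<subseteq> \<A>"
      by (auto simp: S2_def)
    then show "indep S2 (edges (difference_graph \<A> (matching_graph n)))"
      using same by (fastforce simp: indep_difference_graph_iff S2_def)
  qed (use assms in \<open>auto simp: S2_def\<close>)
  moreover have "card S \<le> card S1 * card S2"
  proof -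
    have "S \<subseteq> case_prod (juxtapose m) ` (S1 \<times> S2)"
    proof
      fix x
      assume "x \<in> S"
      then obtain \<pi> \<sigma> where "x = juxtapose m \<pi> \<sigma>" "\<pi> \<in> \<F>" "\<sigma> \<in> \<A>"
        using S by auto
      then show "x \<in> case_prod (juxtapose m) ` (S1 \<times> S2)"
        using \<open>x \<in> S\<close> by (intro image_eqI[of _ _ "(\<pi>, \<sigma>)"]) (auto simp: S1_def S2_def)
    qed
    moreover have "finite (S1 \<times> S2)"
      using assms by (simp add: S1_def S2_def)
    ultimately show ?thesis
      by (metis card_cartesian_product surj_card_le)
  qed
  ultimately show "card S \<le> ?f * ?a"
    by (meson le_trans mult_le_mono)
qed

section \<open>Powers of a family and the choice of the exponent\<close>

text \<open>Each step juxtaposes one more copy of \<open>\<A>\<close>. Injectivity of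
  \<open>juxtapose\<close> on the product makes the cardinality exactly multiplicative, while the
  independence number is only submultiplicative.\<close>

lemma matching_graph_power_family:
  assumes "even n" "finite \<A>" "\<A> \<subseteq> blank_perms (matching_graph n) b"
  shows "\<exists>\<F>. \<F> \<subseteq> blank_perms (matching_graph (k * n)) (k * b) \<and> finite \<F>
    \<and> card \<F> = card \<A> ^ k
    \<and> independence_number (difference_graph \<F> (matching_graph (k * n)))
        \<le> independence_number (difference_graph \<A> (matching_graph n)) ^ k"
proof (induction k)
  case 0
  \<comment> \<open>The zeroth power consists of the empty sequence alone, over the graph without
    vertices; the bound is the empty product \<open>1\<close>.\<close>
  have "independence_number (difference_graph {[]} (matching_graph 0)) \<le> 1"
    by (rule independence_number_le) (auto simp: subset_singleton_iff)
  then show ?case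
    by (intro exI[of _ "{[]}"]) (simp add: blank_perms_def)
next
  case (Suc k)
  then obtain \<F> where \<F>: "\<F> \<subseteq> blank_perms (matching_graph (k * n)) (k * b)" "finite \<F>"
    and card: "card \<F> = card \<A> ^ k"
    and ind: "independence_number (difference_graph \<F> (matching_graph (k * n)))
        \<le> independence_number (difference_graph \<A> (matching_graph n)) ^ k"
    by blast
  let ?J = "case_prod (juxtapose (k * n)) ` (\<F> \<times> \<A>)"
  have "length \<pi> = k * n + k * b" if "\<pi> \<in> \<F>" for \<pi>
    using that \<F>(1) length_blank_perms by blast
  then have "inj_on (case_prod (juxtapose (k * n))) (\<F> \<times> \<A>)"
    by (auto simp: inj_on_def juxtapose_eq_iff)
  then have "card ?J = card \<A> ^ Suc k"
    by (simp add: card_image card_cartesian_product card)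
  moreover have "?J \<subseteq> blank_perms (matching_graph (Suc k * n)) (Suc k * b)"
    using \<F>(1) assms(3) juxtapose_in_blank_perms[of _ "k * n" "k * b" _ n b]
    by (auto simp: add.commute)
  moreover have "independence_number (difference_graph ?J (matching_graph (Suc k * n)))
    \<le> independence_number (difference_graph \<A> (matching_graph n)) ^ Suc k"
    using order_trans[OF independence_number_juxtapose[OF _ \<F>(2) assms(2) \<F>(1), of n]
        mult_le_mono1[OF ind]] assms(1)
    by (simp add: add.commute mult.commute)
  ultimately show ?case
    using \<F>(2) assms(2) by (intro exI[of _ ?J]) blast
qed

text \<open>Both sides say that the logarithm is at most \<open>j\<close>; since \<open>j\<close> is
  a natural number, neither the ceiling nor the truncation by \<open>nat\<close> changes this. It
  identifies the least exponent whose power of \<open>q\<close> reaches \<open>p\<close>.\<close>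

lemma le_power_iff_ceiling_log:
  assumes "q \<ge> 2" "p > 0"
  shows "p \<le> q ^ j \<longleftrightarrow> nat \<lceil>log (real q) (real p)\<rceil> \<le> j"
proof -
  have "p \<le> q ^ j \<longleftrightarrow> real p \<le> real q powr real j"
    using assms by (simp add: powr_realpow flip: of_nat_power)
  also have "\<dots> \<longleftrightarrow> log (real q) (real p) \<le> real j"
    using assms by (simp add: log_le_iff)
  also have "\<dots> \<longleftrightarrow> nat \<lceil>log (real q) (real p)\<rceil> \<le> j"
    by linarith
  finally show ?thesis .
qed

theorem theorem6:
  fixes \<A> :: "nat option list set" and b p q l P :: nat and a :: real
  assumes "finite \<A>"
    and "\<A> \<subseteq> blank_perms (matching_graph 2) b"
    and "q = card \<A>" and "q \<ge> 2"
    and "p > 0"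
    and "l = 2 * nat \<lceil>log (real q) (real p)\<rceil>"
    and "P = (LEAST x. x \<ge> p \<and> (\<exists>k. x = q ^ k))"
    and "a = real (independence_number (difference_graph \<A> (matching_graph 2))) / real q"
  shows "\<exists>c \<F>. \<F> \<subseteq> blank_perms (matching_graph l) c \<and> finite \<F> \<and> card \<F> = p
    \<and> real (independence_number (difference_graph \<F> (matching_graph l)))
        \<le> real P * a ^ (l div 2)"
proof -
  define k where "k = nat \<lceil>log (real q) (real p)\<rceil>"
  note pow = le_power_iff_ceiling_log[OF assms(4,5), folded k_def]
  have l: "l = k * 2"
    using assms(6) by (simp add: k_def)
  \<comment> \<open>By \<open>pow\<close>, \<open>q ^ k\<close> is at least \<open>p\<close>, and
    any power \<open>q ^ j\<close> that is at least \<open>p\<close> has \<open>k \<le> j\<close>,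
    hence is at least \<open>q ^ k\<close>.\<close>
  have P: "P = q ^ k"
    unfolding assms(7) using pow assms(4) by (intro Least_equality) (auto intro!: power_increasing)
  obtain \<G> where \<G>: "\<G> \<subseteq> blank_perms (matching_graph l) (k * b)" "finite \<G>" "card \<G> = q ^ k"
    and ind: "independence_number (difference_graph \<G> (matching_graph l))
        \<le> independence_number (difference_graph \<A> (matching_graph 2)) ^ k"
    using matching_graph_power_family[OF _ assms(1,2), of k] l assms(3) by auto
  obtain \<F> where \<F>: "\<F> \<subseteq> \<G>" "card \<F> = p" "finite \<F>"
    using obtain_subset_with_card_n[of p \<G>] pow \<G>(3) by auto
  have "independence_number (difference_graph \<F> (matching_graph l))
      \<le> independence_number (difference_graph \<A> (matching_graph 2)) ^ k"
    using independence_number_difference_graph_mono[OF \<G>(2) \<F>(1)] ind le_trans by blast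
  then have "real (independence_number (difference_graph \<F> (matching_graph l)))
      \<le> real (independence_number (difference_graph \<A> (matching_graph 2))) ^ k"
    by (simp flip: of_nat_power)
  \<comment> \<open>The factor \<open>P = q ^ k\<close> cancels the denominator of
    \<open>a ^ k\<close>, as \<open>q\<close> is nonzero and \<open>l div 2 = k\<close>.\<close>
  also have "\<dots> = real P * a ^ (l div 2)"
    using assms(4) by (simp add: P l assms(8) power_divide)
  finally show ?thesis
    using \<F> \<G>(1) by blast
qed

end
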